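(* Let $P=(X,\prec)$ be a finite poset with $|X|=n$, let $X=Y\sqcup Z$ be a partition, and let $t\ge1$ be an integer. Let $A$ be the set of pairs $(u,v)$ with $u\prec v$ and either $u,v\in Y$ or $u,v\in Z$. Let $C$ and $C'$ be sets of pairs $(y,z)$ with $y\in Y$ and $z\in Z$. Then, coefficient-wise as polynomials in $q$, $$\Omega_q(C\cup C'\cup A,t)\cdot\Omega_q(A,t)\ \geqslant_q\ \Omega_q(C\cup A,t)\cdot\Omega_q(C'\cup A,t).$$
   Context: For a set $R$ of ordered pairs of elements of $X$, $\Omega_q(R,t):=\sum_g q^{|g|-n}$, where the sum is over all maps $g:X\to[t]$ such that $g(u)\le g(v)$ for every $(u,v)\in R$, and $|g|:=\sum_{x\in X}g(x)$. (In the paper's language, $C,C'$ are $Y$-minimizing collections and the union of constraint sets corresponds to intersecting the corresponding collections.) $\geqslant_q$ means every coefficient of the difference is nonnegative. *)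

theory Defs
  imports "HOL-Library.FuncSet" "HOL-Computational_Algebra.Polynomial"
begin

definition order_maps :: "'a set \<Rightarrow> ('a \<times> 'a) set \<Rightarrow> nat \<Rightarrow> ('a \<Rightarrow> nat) set" where
  "order_maps X R t = {g \<in> X \<rightarrow>\<^sub>E {1..t}. \<forall>(u, v) \<in> R. g u \<le> g v}"

text \<open>
  The sum of \<open>q ^ (|g| - n)\<close> over the maps above, where \<open>n = card X\<close> and \<open>|g|\<close> is the sum of the
  values of \<open>g\<close>. The subtraction of naturals does not truncate, since \<open>g\<close> takes values
  \<open>\<ge> 1\<close> on \<open>X\<close>.
\<close>

definition Omega_q :: "'a set \<Rightarrow> ('a \<times> 'a) set \<Rightarrow> nat \<Rightarrow> int poly" where
  "Omega_q X R t = (\<Sum>g\<in>order_maps X R t. monom 1 ((\<Sum>x\<in>X. g x) - card X))"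

text \<open>Coefficientwise comparison; not the library's order \<open>\<ge>\<close> on polynomials, which is
  determined by the sign of the leading coefficient of the difference.\<close>

definition coeff_ge :: "int poly \<Rightarrow> int poly \<Rightarrow> bool" (infix "\<ge>\<^sub>q" 50) where
  "p \<ge>\<^sub>q r \<longleftrightarrow> (\<forall>k. coeff (p - r) k \<ge> 0)"

definition within_parts :: "('a \<Rightarrow> 'a \<Rightarrow> bool) \<Rightarrow> 'a set \<Rightarrow> 'a set \<Rightarrow> ('a \<times> 'a) set" where
  "within_parts prec Y Z = {(u, v). prec u v \<and> (u \<in> Y \<and> v \<in> Y \<or> u \<in> Z \<and> v \<in> Z)}"

end

theory Submission
  imports Defs
begin

text \<open>
  A pair of maps \<open>(f, g)\<close> is sorted according to its pointwise minimum \<open>a\<close> and maximum \<open>b\<close>; these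
  determine \<open>|f| + |g|\<close>, so it suffices to compare the two sides for fixed \<open>a\<close> and \<open>b\<close>. Then
  \<open>f\<close> amounts to a subset of \<open>D = {x. a x < b x}\<close>, the points of \<open>Y\<close> where \<open>f\<close> equals \<open>b\<close>
  together with the points of \<open>Z\<close> where \<open>f\<close> equals \<open>a\<close>, and \<open>g\<close> to its complement. The pairs in
  which both maps respect \<open>A\<close> form a Boolean algebra of subsets of \<open>D\<close>, in which each of \<open>C\<close>
  and \<open>C'\<close> defines a down-set. Kleitman's correlation inequality for down-sets, used once for two
  down-sets and once for a down-set and an up-set, compares the two sides.
\<close>

section \<open>The four functions theorem and down-sets\<close>

text \<open>The four functions inequality over a one-element ground set; the index says whether the
  element is present. Both mixed products on the left are at most \<open>c1 * d0\<close>, while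
  hypotheses \<open>00\<close> and \<open>11\<close> bound their product. This is enough to bound
  their sum.\<close>

lemma four_functions_two_point:
  fixes a0 a1 b0 b1 c0 c1 d0 d1 :: real
  assumes nonneg: "0 \<le> a0" "0 \<le> a1" "0 \<le> b0" "0 \<le> b1" "0 \<le> c0" "0 \<le> c1" "0 \<le> d0" "0 \<le> d1"
    and 00: "a0 * b0 \<le> c0 * d0" and 01: "a0 * b1 \<le> c1 * d0"
    and 10: "a1 * b0 \<le> c1 * d0" and 11: "a1 * b1 \<le> c1 * d1"
  shows "(a0 + a1) * (b0 + b1) \<le> (c0 + c1) * (d0 + d1)"
proof -
  define u where "u = c1 * d0"
  define p where "p = a0 * b1"
  define r where "r = a1 * b0"
  have pr: "0 \<le> p" "0 \<le> r" "p \<le> u" "r \<le> u"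
    using assms by (auto simp: u_def p_def r_def)
  have "p * r = (a0 * b0) * (a1 * b1)"
    by (simp add: p_def r_def)
  also have "\<dots> \<le> (c0 * d0) * (c1 * d1)"
    using nonneg 00 11 by (intro mult_mono[OF 00 11]) auto
  also have "\<dots> = u * (c0 * d1)"
    by (simp add: u_def)
  finally have prod: "p * r \<le> u * (c0 * d1)" .
  have "p + r \<le> u + c0 * d1"
  proof (cases "u = 0")
    case True
    then show ?thesis using pr nonneg by simp
  next
    case False
    with pr have "u > 0" by linarith
    \<comment> \<open>Two numbers in \<open>[0, u]\<close> with a given product have the largest sum
      when one of them equals \<open>u\<close>; expanding this product says so.\<close>
    have "0 \<le> (u - p) * (u - r)"
      using pr by simp
    then have "u * (p + r) \<le> u * u + p * r"
      by (simp add: algebra_simps)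
    also have "\<dots> \<le> u * (u + c0 * d1)"
      using prod by (simp add: algebra_simps)
    finally show ?thesis
      using \<open>u > 0\<close> by simp
  qed
  then show ?thesis
    using 00 11 by (simp add: u_def p_def r_def algebra_simps)
qed

lemma sum_Pow_insert:
  fixes f :: "'a set \<Rightarrow> real"
  assumes "finite D" "x \<notin> D"
  shows "sum f (Pow (insert x D)) = (\<Sum>S\<in>Pow D. f S + f (insert x S))"
proof -
  have "inj_on (insert x) (Pow D)"
    using assms(2) by (auto simp: inj_on_def)
  moreover have "Pow D \<inter> insert x ` Pow D = {}"
    using assms(2) by auto
  ultimately show ?thesis
    using assms(1) by (simp add: Pow_insert sum.union_disjoint sum.reindex sum.distrib)
qed

text \<open>The Ahlswede-Daykin inequality, by induction on the ground set: summing out one element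
  preserves the hypothesis, by the two-point case applied to each pair \<open>S\<close>,
  \<open>T\<close>.\<close>

theorem four_functions:
  fixes \<alpha> \<beta> \<gamma> \<delta> :: "'a set \<Rightarrow> real"
  assumes "finite D"
    and "\<And>S. 0 \<le> \<alpha> S" "\<And>S. 0 \<le> \<beta> S" "\<And>S. 0 \<le> \<gamma> S" "\<And>S. 0 \<le> \<delta> S"
    and "\<And>S T. S \<subseteq> D \<Longrightarrow> T \<subseteq> D \<Longrightarrow> \<alpha> S * \<beta> T \<le> \<gamma> (S \<union> T) * \<delta> (S \<inter> T)"
  shows "sum \<alpha> (Pow D) * sum \<beta> (Pow D) \<le> sum \<gamma> (Pow D) * sum \<delta> (Pow D)"
  using assms
proof (induction D arbitrary: \<alpha> \<beta> \<gamma> \<delta> rule: finite_induct)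
  case empty
  then show ?case
    using empty(5)[of "{}" "{}"] by simp
next
  case (insert x D)
  define ext :: "('a set \<Rightarrow> real) \<Rightarrow> 'a set \<Rightarrow> real" where "ext = (\<lambda>f S. f S + f (insert x S))"
  have "ext \<alpha> S * ext \<beta> T \<le> ext \<gamma> (S \<union> T) * ext \<delta> (S \<inter> T)" if "S \<subseteq> D" "T \<subseteq> D" for S T
  proof -
    note * = insert.prems(5)
    \<comment> \<open>If \<open>x\<close> is added to just one of \<open>S\<close> and
      \<open>T\<close>, it enters the union but not the intersection. Hence both mixed products are
      bounded by the same term.\<close>
    have "x \<notin> S" "x \<notin> T" "S \<subseteq> insert x D" "T \<subseteq> insert x D"
      "insert x S \<subseteq> insert x D" "insert x T \<subseteq> insert x D"
      using that insert.hyps(2) by auto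
    then show ?thesis
      unfolding ext_def using insert.prems(1-4) *[of S T] *[of "insert x S" T]
        *[of S "insert x T"] *[of "insert x S" "insert x T"]
      by (intro four_functions_two_point) auto
  qed
  then have "sum (ext \<alpha>) (Pow D) * sum (ext \<beta>) (Pow D) \<le> sum (ext \<gamma>) (Pow D) * sum (ext \<delta>) (Pow D)"
    using insert.prems(1-4) by (intro insert.IH) (auto simp: ext_def)
  then show ?case
    using insert.hyps by (simp add: sum_Pow_insert ext_def)
qed

text \<open>Kleitman's inequality inside a lattice \<open>B\<close> of sets: the four functions are
  the indicators of \<open>U\<close>, \<open>W\<close>, \<open>B\<close> and
  \<open>U \<inter> W\<close>. For \<open>S\<close> in \<open>U\<close> and \<open>T\<close> in
  \<open>W\<close>, the intersection lies in both down-sets and the union lies in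
  \<open>B\<close>.\<close>

lemma down_sets_positively_correlated:
  assumes "finite D" "B \<subseteq> Pow D" "U \<subseteq> B" "W \<subseteq> B"
    and union: "\<And>S T. S \<in> B \<Longrightarrow> T \<in> B \<Longrightarrow> S \<union> T \<in> B"
    and inter: "\<And>S T. S \<in> B \<Longrightarrow> T \<in> B \<Longrightarrow> S \<inter> T \<in> B"
    and downU: "\<And>S T. S \<in> U \<Longrightarrow> T \<in> B \<Longrightarrow> T \<subseteq> S \<Longrightarrow> T \<in> U"
    and downW: "\<And>S T. S \<in> W \<Longrightarrow> T \<in> B \<Longrightarrow> T \<subseteq> S \<Longrightarrow> T \<in> W"
  shows "card U * card W \<le> card B * card (U \<inter> W)"
proof -
  let ?i = "\<lambda>F S. if S \<in> F then 1 else 0 :: real"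
  have card: "sum (?i F) (Pow D) = real (card F)" if "F \<subseteq> B" for F
  proof -
    have "Pow D \<inter> F = F"
      using that assms(2) by auto
    then show ?thesis
      using assms(1) by (simp flip: sum.inter_restrict)
  qed
  have "?i U S * ?i W T \<le> ?i B (S \<union> T) * ?i (U \<inter> W) (S \<inter> T)" for S T
  proof (cases "S \<in> U \<and> T \<in> W")
    case True
    then have "S \<in> B" "T \<in> B"
      using assms(3,4) by auto
    then have "S \<union> T \<in> B" "S \<inter> T \<in> B"
      using union inter by auto
    then show ?thesis
      using True downU[of S "S \<inter> T"] downW[of T "S \<inter> T"] by auto
  qed auto
  then have "sum (?i U) (Pow D) * sum (?i W) (Pow D) \<le> sum (?i B) (Pow D) * sum (?i (U \<inter> W)) (Pow D)"
    using assms(1) by (intro four_functions) auto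
  moreover have "U \<inter> W \<subseteq> B"
    using assms(3) by auto
  ultimately have "real (card U) * real (card W) \<le> real (card B) * real (card (U \<inter> W))"
    using assms(3,4) by (simp only: card order_refl)
  then show ?thesis
    by (metis of_nat_le_iff of_nat_mult)
qed

text \<open>Complementation turns the down-set \<open>W\<close> into an up-set \<open>V\<close> of
  \<open>B\<close> of the same size. A down-set \<open>U\<close> meets \<open>V\<close> in at most
  the average proportion and \<open>W\<close> in at least that proportion, so
  \<open>card U * card W\<close> separates the two counts, each multiplied by
  \<open>card B\<close>.\<close>

lemma card_down_set_complement_le:
  assumes "finite D" "B \<subseteq> Pow D" "U \<subseteq> B" "W \<subseteq> B"
    and union: "\<And>S T. S \<in> B \<Longrightarrow> T \<in> B \<Longrightarrow> S \<union> T \<in> B"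
    and inter: "\<And>S T. S \<in> B \<Longrightarrow> T \<in> B \<Longrightarrow> S \<inter> T \<in> B"
    and compl: "\<And>S. S \<in> B \<Longrightarrow> D - S \<in> B"
    and downU: "\<And>S T. S \<in> U \<Longrightarrow> T \<in> B \<Longrightarrow> T \<subseteq> S \<Longrightarrow> T \<in> U"
    and downW: "\<And>S T. S \<in> W \<Longrightarrow> T \<in> B \<Longrightarrow> T \<subseteq> S \<Longrightarrow> T \<in> W"
  shows "card {S \<in> U. D - S \<in> W} \<le> card (U \<inter> W)"
proof (cases "B = {}")
  case True
  then show ?thesis using assms(3) by auto
next
  case False
  define V where "V = {S \<in> B. D - S \<in> W}"
  define N where "N = B - V"
  have fin: "finite B"
    using assms(1,2) by (meson finite_Pow_iff finite_subset)
  have finU: "finite U"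
    using assms(3) fin by (rule finite_subset)
  have "B \<noteq> {}" by fact
  then have pos: "card B > 0"
    using fin by (simp add: card_gt_0_iff)
  have VW: "V = (\<lambda>S. D - S) ` W"
  proof (intro equalityI subsetI)
    fix S assume "S \<in> V"
    then have "S = D - (D - S)" "D - S \<in> W"
      using assms(2) by (auto simp: V_def)
    then show "S \<in> (\<lambda>S. D - S) ` W" by (rule image_eqI)
  next
    fix S assume "S \<in> (\<lambda>S. D - S) ` W"
    then obtain T where T: "T \<in> W" "S = D - T" by auto
    then have "D - S = T" "T \<in> B"
      using assms(2,4) by auto
    then show "S \<in> V"
      using T compl by (simp add: V_def)
  qed
  have "inj_on (\<lambda>S. D - S) W"
    using assms(2,4) by (intro inj_onI) blast
  then have cardV: "card V = card W"
    unfolding VW by (rule card_image)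
  have "V \<subseteq> B"
    by (auto simp: V_def)
  then have cardN: "card B = card N + card V"
    unfolding N_def using fin by (metis card_Diff_subset card_mono finite_subset le_add_diff_inverse2)
  have cardU: "card U = card (U \<inter> N) + card (U \<inter> V)"
  proof -
    have "U = (U \<inter> N) \<union> (U \<inter> V)" "(U \<inter> N) \<inter> (U \<inter> V) = {}"
      using assms(3) by (auto simp: N_def)
    then show ?thesis
      using finU by (metis card_Un_disjoint finite_Int)
  qed
  have downN: "T \<in> N" if "S \<in> N" "T \<in> B" "T \<subseteq> S" for S T
  proof -
    have "D - S \<subseteq> D - T" "S \<in> B"
      using that by (auto simp: N_def)
    then show ?thesis
      using that downW[of "D - T" "D - S"] compl by (auto simp: N_def V_def)
  qed
  \<comment> \<open>The complement \<open>N\<close> of the up-set \<open>V\<close> is a down-set.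
    Subtracting this inequality from \<open>card U * card B\<close> gives the negative correlation
    of \<open>U\<close> with \<open>V\<close>.\<close>
  have "card U * card N \<le> card B * card (U \<inter> N)"
    by (rule down_sets_positively_correlated[OF assms(1-3) _ union inter downU downN])
      (auto simp: N_def)
  then have "int (card U) * int (card N) \<le> int (card B) * int (card (U \<inter> N))"
    by (metis of_nat_le_iff of_nat_mult)
  moreover have "int (card N) = int (card B) - int (card W)"
    using cardN cardV by simp
  moreover have "int (card (U \<inter> N)) = int (card U) - int (card (U \<inter> V))"
    using cardU by simp
  ultimately have "int (card B) * int (card (U \<inter> V)) \<le> int (card U) * int (card W)"
    by (simp add: algebra_simps)
  then have "card B * card (U \<inter> V) \<le> card U * card W"
    by (metis of_nat_le_iff of_nat_mult)
  also have "\<dots> \<le> card B * card (U \<inter> W)"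
    by (rule down_sets_positively_correlated[OF assms(1-4) union inter downU downW])
  finally have "card (U \<inter> V) \<le> card (U \<inter> W)"
    using pos by simp
  moreover have "U \<inter> V = {S \<in> U. D - S \<in> W}"
    using assms(3) by (auto simp: V_def)
  ultimately show ?thesis by simp
qed

section \<open>Choosing between a pointwise minimum and maximum\<close>

text \<open>The role of \<open>S\<close> is reversed off \<open>Y\<close>: when \<open>a\<close>
  lies below \<open>b\<close>, enlarging \<open>S\<close> raises values on \<open>Y\<close> and
  lowers them elsewhere. This makes constraints from \<open>Y\<close> to \<open>Z\<close> monotone
  in \<open>S\<close>.\<close>

definition select :: "'a set \<Rightarrow> 'a set \<Rightarrow> ('a \<Rightarrow> nat) \<Rightarrow> ('a \<Rightarrow> nat) \<Rightarrow> 'a set \<Rightarrow> 'a \<Rightarrow> nat" where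
  "select X Y a b S = (\<lambda>x\<in>X. if x \<in> S \<longleftrightarrow> x \<in> Y then b x else a x)"

text \<open>Shrinking \<open>S\<close> can only lower the value at \<open>y\<close> and raise the
  value at \<open>z\<close>. This is why \<open>C\<close> and \<open>C'\<close> define
  down-sets.\<close>

lemma select_antitone:
  assumes "\<And>x. x \<in> X \<Longrightarrow> a x \<le> b x" "T \<subseteq> S" "y \<in> X \<inter> Y" "z \<in> X - Y"
    and "select X Y a b S y \<le> select X Y a b S z"
  shows "select X Y a b T y \<le> select X Y a b T z"
proof -
  have "select X Y a b T y \<le> select X Y a b S y"
    using assms(1)[of y] assms(2,3) by (auto simp: select_def)
  also have "\<dots> \<le> select X Y a b S z"
    by fact
  also have "\<dots> \<le> select X Y a b T z"
    using assms(1)[of z] assms(2,4) by (auto simp: select_def)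
  finally show ?thesis .
qed

text \<open>On either side of the partition, union and intersection of sets act as pointwise maximum
  and minimum of the selected maps, in an order depending on the side. Both operations preserve an
  inequality between two points of the same side.\<close>

lemma select_Un_Int_le:
  assumes "\<And>x. x \<in> X \<Longrightarrow> a x \<le> b x" "u \<in> X" "v \<in> X" "u \<in> Y \<longleftrightarrow> v \<in> Y"
    and "select X Y a b S u \<le> select X Y a b S v" "select X Y a b T u \<le> select X Y a b T v"
  shows "select X Y a b (S \<union> T) u \<le> select X Y a b (S \<union> T) v"
    and "select X Y a b (S \<inter> T) u \<le> select X Y a b (S \<inter> T) v"
proof -
  let ?s = "select X Y a b"
  have Un_Int: "?s (S \<union> T) x = (if x \<in> Y then max (?s S x) (?s T x) else min (?s S x) (?s T x))"
    "?s (S \<inter> T) x = (if x \<in> Y then min (?s S x) (?s T x) else max (?s S x) (?s T x))"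
    if "x \<in> X" for x
    using assms(1)[OF that] that by (auto simp: select_def)
  show "?s (S \<union> T) u \<le> ?s (S \<union> T) v" "?s (S \<inter> T) u \<le> ?s (S \<inter> T) v"
    using assms(2-6) by (auto simp: Un_Int intro: min.mono max.mono)
qed

lemma order_maps_Un:
  "order_maps X (R \<union> R') t = order_maps X R t \<inter> order_maps X R' t"
  by (auto simp: order_maps_def)

lemma finite_order_maps: "finite X \<Longrightarrow> finite (order_maps X R t)"
  by (rule finite_subset[of _ "X \<rightarrow>\<^sub>E {1..t}"]) (auto simp: order_maps_def finite_PiE)

lemma card_selections_le:
  fixes X Y Z :: "'a set" and t :: nat
  assumes "finite X" "X = Y \<union> Z" "Y \<inter> Z = {}"
    and A: "A \<subseteq> Y \<times> Y \<union> Z \<times> Z" and C: "C \<subseteq> Y \<times> Z" and C': "C' \<subseteq> Y \<times> Z"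
    and ab: "\<And>x. x \<in> X \<Longrightarrow> 1 \<le> a x \<and> a x \<le> b x \<and> b x \<le> t"
    and D: "D = {x \<in> X. a x < b x}"
  defines "sel \<equiv> select X Y a b"
  shows "card {S \<in> Pow D. sel S \<in> order_maps X (C \<union> A) t \<and> sel (D - S) \<in> order_maps X (C' \<union> A) t}
    \<le> card {S \<in> Pow D. sel S \<in> order_maps X (C \<union> C' \<union> A) t \<and> sel (D - S) \<in> order_maps X A t}"
    (is "card ?L \<le> card ?R")
proof -
  have le: "\<And>x. x \<in> X \<Longrightarrow> a x \<le> b x"
    using ab by blast
  have sel_in: "sel S \<in> X \<rightarrow>\<^sub>E {1..t}" for S
    using ab by (fastforce simp: sel_def select_def intro: order_trans)
  have memI: "sel S \<in> order_maps X R t \<longleftrightarrow> (\<forall>(u, v) \<in> R. sel S u \<le> sel S v)" for R S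
    using sel_in by (auto simp: order_maps_def)
  have A_memD: "u \<in> X" "v \<in> X" "u \<in> Y \<longleftrightarrow> v \<in> Y" if "(u, v) \<in> A" for u v
    using that A assms(2,3) by auto
  have A_closed: "sel (S \<union> T) \<in> order_maps X A t" "sel (S \<inter> T) \<in> order_maps X A t"
    if S: "sel S \<in> order_maps X A t" and T: "sel T \<in> order_maps X A t" for S T
  proof -
    have "sel (S \<union> T) u \<le> sel (S \<union> T) v \<and> sel (S \<inter> T) u \<le> sel (S \<inter> T) v" if uv: "(u, v) \<in> A" for u v
    proof -
      have "sel S u \<le> sel S v" "sel T u \<le> sel T v"
        using uv S T by (auto simp: order_maps_def)
      then show ?thesis
        unfolding sel_def using select_Un_Int_le[of X a b, OF le A_memD[OF uv]] by simp
    qed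
    then show "sel (S \<union> T) \<in> order_maps X A t" "sel (S \<inter> T) \<in> order_maps X A t"
      by (auto simp: memI)
  qed
  have down: "sel T \<in> order_maps X R t"
    if S: "sel S \<in> order_maps X R t" and T: "T \<subseteq> S" and R: "R \<subseteq> Y \<times> Z" for R S T
  proof -
    have "sel T y \<le> sel T z" if yz: "(y, z) \<in> R" for y z
    proof -
      have "y \<in> X \<inter> Y" "z \<in> X - Y" "sel S y \<le> sel S z"
        using yz R S assms(2,3) by (auto simp: order_maps_def)
      then show ?thesis
        unfolding sel_def using select_antitone[of X a b, OF le T] by simp
    qed
    then show ?thesis
      by (auto simp: memI)
  qed
  \<comment> \<open>Imposing \<open>A\<close> on both \<open>S\<close> and \<open>D - S\<close>
    makes \<open>B\<close> closed under complement as well as union and intersection. The left side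
    then counts \<open>S\<close> in \<open>U\<close> with \<open>D - S\<close> in \<open>W\<close>,
    and the right side counts \<open>U \<inter> W\<close>.\<close>
  define B where "B = {S \<in> Pow D. sel S \<in> order_maps X A t \<and> sel (D - S) \<in> order_maps X A t}"
  define U where "U = {S \<in> B. sel S \<in> order_maps X C t}"
  define W where "W = {S \<in> B. sel S \<in> order_maps X C' t}"
  have dd: "D - (D - S) = S" if "S \<subseteq> D" for S
    using that by auto
  have "?L = {S \<in> U. D - S \<in> W}"
    by (auto simp: U_def W_def B_def order_maps_Un dd)
  also have "card \<dots> \<le> card (U \<inter> W)"
  proof (rule card_down_set_complement_le)
    show "finite D"
      using assms(1) D by simp
    show "S \<union> T \<in> B" if "S \<in> B" "T \<in> B" for S T
      using that A_closed(1)[of S T] A_closed(2)[of "D - S" "D - T"] by (auto simp: B_def Diff_Un)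
    show "S \<inter> T \<in> B" if "S \<in> B" "T \<in> B" for S T
      using that A_closed(2)[of S T] A_closed(1)[of "D - S" "D - T"] by (auto simp: B_def Diff_Int)
    show "D - S \<in> B" if "S \<in> B" for S
      using that by (auto simp: B_def dd)
    show "T \<in> U" if "S \<in> U" "T \<in> B" "T \<subseteq> S" for S T
      using that down[of S C T] C by (auto simp: U_def)
    show "T \<in> W" if "S \<in> W" "T \<in> B" "T \<subseteq> S" for S T
      using that down[of S C' T] C' by (auto simp: W_def)
  qed (auto simp: B_def U_def W_def)
  also have "U \<inter> W = ?R"
    by (auto simp: U_def W_def B_def order_maps_Un)
  finally show ?thesis .
qed

section \<open>Fibres of the pointwise minimum and maximum\<close>

definition min_max :: "'a set \<Rightarrow> ('a \<Rightarrow> nat) \<times> ('a \<Rightarrow> nat) \<Rightarrow> ('a \<Rightarrow> nat) \<times> ('a \<Rightarrow> nat)" where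
  "min_max X = (\<lambda>(f, g). (\<lambda>x\<in>X. min (f x) (g x), \<lambda>x\<in>X. max (f x) (g x)))"

text \<open>The term \<open>2 * card X\<close> undoes the shift of the exponent by
  \<open>card X\<close> in each of the two factors, without subtraction.\<close>

definition pairs :: "'a set \<Rightarrow> ('a \<times> 'a) set \<Rightarrow> ('a \<times> 'a) set \<Rightarrow> nat \<Rightarrow> nat
    \<Rightarrow> (('a \<Rightarrow> nat) \<times> ('a \<Rightarrow> nat)) set" where
  "pairs X R R' t k = {(f, g) \<in> order_maps X R t \<times> order_maps X R' t.
     sum f X + sum g X = k + 2 * card X}"

lemma finite_pairs: "finite X \<Longrightarrow> finite (pairs X R R' t k)"
  by (rule finite_subset[of _ "order_maps X R t \<times> order_maps X R' t"])
    (auto simp: pairs_def finite_order_maps)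

lemma coeff_Omega_q_mult:
  assumes "finite X"
  shows "coeff (Omega_q X R t * Omega_q X R' t) k = int (card (pairs X R R' t k))"
proof -
  let ?M = "order_maps X R t" and ?M' = "order_maps X R' t"
  let ?e = "\<lambda>f. sum f X - card X"
  \<comment> \<open>All values are at least 1, so the natural subtraction in the exponents is
    exact.\<close>
  have ge: "card X \<le> sum f X" if "f \<in> order_maps X Q t" for f Q
  proof -
    have "(\<Sum>x\<in>X. 1) \<le> sum f X"
      using that by (intro sum_mono) (auto simp: order_maps_def PiE_iff)
    then show ?thesis by simp
  qed
  have "Omega_q X R t * Omega_q X R' t = (\<Sum>(f, g)\<in>?M \<times> ?M'. monom 1 (?e f + ?e g))"
    by (simp add: Omega_q_def sum_product mult_monom sum.cartesian_product)
  then have "coeff (Omega_q X R t * Omega_q X R' t) k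
      = (\<Sum>p\<in>?M \<times> ?M'. if ?e (fst p) + ?e (snd p) = k then 1 else 0)"
    by (simp add: coeff_sum case_prod_unfold)
  also have "\<dots> = int (card {p \<in> ?M \<times> ?M'. ?e (fst p) + ?e (snd p) = k})"
    using assms by (simp add: finite_order_maps flip: sum.inter_filter)
  also have "{p \<in> ?M \<times> ?M'. ?e (fst p) + ?e (snd p) = k} = pairs X R R' t k"
  proof (intro set_eqI)
    fix p
    show "p \<in> {p \<in> ?M \<times> ?M'. ?e (fst p) + ?e (snd p) = k} \<longleftrightarrow> p \<in> pairs X R R' t k"
    proof (cases "p \<in> ?M \<times> ?M'")
      case True
      then have "card X \<le> sum (fst p) X" "card X \<le> sum (snd p) X"
        using ge by auto
      with True show ?thesis
        by (auto simp: pairs_def)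
    qed (auto simp: pairs_def)
  qed
  finally show ?thesis .
qed

lemma card_le_if_fibres_le:
  assumes "finite P" "finite Q"
    and "\<And>p. p \<in> P \<Longrightarrow> card {p' \<in> P. h p' = h p} \<le> card {p' \<in> Q. h p' = h p}"
  shows "card P \<le> card Q"
proof -
  have "card P = (\<Sum>i\<in>h ` P. card {p' \<in> P. h p' = i})"
    using sum.group[of P "h ` P" h "\<lambda>_. 1::nat"] assms(1) by simp
  also have "\<dots> \<le> (\<Sum>i\<in>h ` P. card {p' \<in> Q. h p' = i})"
    using assms(3) by (intro sum_mono) auto
  also have "\<dots> = card (\<Union>i\<in>h ` P. {p' \<in> Q. h p' = i})"
    using assms(1,2) by (intro card_UN_disjoint[symmetric]) auto
  also have "\<dots> \<le> card Q"
    using assms(2) by (intro card_mono) auto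
  finally show ?thesis .
qed

text \<open>At a point of \<open>D\<close> exactly one of \<open>S\<close> and \<open>D - S\<close>
  selects \<open>b\<close>; off \<open>D\<close> the values of \<open>a\<close> and \<open>b\<close>
  agree.\<close>

lemma min_max_select:
  assumes "\<And>x. x \<in> X \<Longrightarrow> a x \<le> b x" "a \<in> extensional X" "b \<in> extensional X"
    and "D = {x \<in> X. a x < b x}"
  shows "min_max X (select X Y a b S, select X Y a b (D - S)) = (a, b)"
proof -
  have "min (select X Y a b S x) (select X Y a b (D - S) x) = a x
      \<and> max (select X Y a b S x) (select X Y a b (D - S) x) = b x" if "x \<in> X" for x
    using assms(1)[OF that] that assms(4) by (auto simp: select_def)
  then show ?thesis
    using assms(2,3) by (auto simp: min_max_def extensional_def restrict_def fun_eq_iff)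
qed

lemma select_of_min_max:
  assumes "min_max X (f, g) = (a, b)" "f \<in> extensional X" "g \<in> extensional X"
    and "D = {x \<in> X. a x < b x}"
  obtains S where "S \<subseteq> D" "f = select X Y a b S" "g = select X Y a b (D - S)"
proof
  \<comment> \<open>On \<open>D\<close> the values \<open>a x\<close> and \<open>b x\<close> differ,
    so this equivalence inverts the rule in \<open>select\<close>. Off \<open>D\<close> there is
    nothing to choose.\<close>
  let ?S = "{x \<in> D. f x = b x \<longleftrightarrow> x \<in> Y}"
  have ab: "a = (\<lambda>x\<in>X. min (f x) (g x))" "b = (\<lambda>x\<in>X. max (f x) (g x))"
    using assms(1) by (auto simp: min_max_def)
  show "?S \<subseteq> D" by auto
  have *: "f x = select X Y a b ?S x \<and> g x = select X Y a b (D - ?S) x" for x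
  proof (cases "x \<in> X")
    case True
    then have "a x = min (f x) (g x)" "b x = max (f x) (g x)"
      by (simp_all add: ab)
    with True assms(4) show ?thesis
      by (auto simp: select_def min_def max_def)
  next
    case False
    then show ?thesis
      using assms(2,3) by (simp add: select_def extensional_def)
  qed
  show "f = select X Y a b ?S"
    by (rule ext) (rule conjunct1[OF *])
  show "g = select X Y a b (D - ?S)"
    by (rule ext) (rule conjunct2[OF *])
qed

lemma sum_min_max:
  fixes f g :: "'a \<Rightarrow> nat"
  assumes "min_max X (f, g) = (a, b)"
  shows "sum f X + sum g X = sum a X + sum b X"
proof -
  have "a = (\<lambda>x\<in>X. min (f x) (g x))" "b = (\<lambda>x\<in>X. max (f x) (g x))"
    using assms by (auto simp: min_max_def)
  then have "sum a X + sum b X = (\<Sum>x\<in>X. min (f x) (g x) + max (f x) (g x))"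
    by (simp add: sum.distrib)
  also have "\<dots> = sum f X + sum g X"
    by (simp add: min_def max_def flip: sum.distrib) (auto intro: sum.cong)
  finally show ?thesis by simp
qed

text \<open>Both sets of pairs are split into fibres of \<open>min_max\<close>. Selection
  parametrises each fibre by subsets of \<open>D\<close>, which reduces the comparison to
  \<open>card_selections_le\<close>.\<close>

lemma card_pairs_le:
  fixes X Y Z :: "'a set"
  assumes "finite X" "X = Y \<union> Z" "Y \<inter> Z = {}"
    and "A \<subseteq> Y \<times> Y \<union> Z \<times> Z" "C \<subseteq> Y \<times> Z" "C' \<subseteq> Y \<times> Z"
  shows "card (pairs X (C \<union> A) (C' \<union> A) t k) \<le> card (pairs X (C \<union> C' \<union> A) A t k)"
    (is "card ?P \<le> card ?Q")
proof (rule card_le_if_fibres_le)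
  show "finite ?P" "finite ?Q"
    using assms(1) by (auto intro: finite_pairs)
  fix p assume p: "p \<in> ?P"
  obtain f0 g0 where p0: "p = (f0, g0)" by (cases p)
  obtain a b where ab: "min_max X p = (a, b)" by (cases "min_max X p")
  define D where "D = {x \<in> X. a x < b x}"
  define pr where "pr = (\<lambda>S. (select X Y a b S, select X Y a b (D - S)))"
  have f0g0: "f0 \<in> X \<rightarrow>\<^sub>E {1..t}" "g0 \<in> X \<rightarrow>\<^sub>E {1..t}"
    using p by (auto simp: p0 pairs_def order_maps_def)
  have ab_eq: "a = (\<lambda>x\<in>X. min (f0 x) (g0 x))" "b = (\<lambda>x\<in>X. max (f0 x) (g0 x))"
    using ab by (auto simp: p0 min_max_def)
  have bounds: "1 \<le> a x \<and> a x \<le> b x \<and> b x \<le> t" if "x \<in> X" for x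
    using that PiE_mem[OF f0g0(1) that] PiE_mem[OF f0g0(2) that] by (auto simp: ab_eq)
  have ext: "a \<in> extensional X" "b \<in> extensional X"
    by (auto simp: ab_eq)
  have key: "min_max X (pr S) = (a, b)" for S
    unfolding pr_def using bounds ext D_def by (intro min_max_select) auto
  \<comment> \<open>The total weight depends only on \<open>a\<close> and \<open>b\<close>, so the
    value read off from \<open>p\<close> is shared by every pair \<open>pr S\<close>.\<close>
  have weight: "sum a X + sum b X = k + 2 * card X"
    using p sum_min_max[of X f0 g0 a b] ab by (simp add: p0 pairs_def)
  define sels where "sels = (\<lambda>R R'. {S \<in> Pow D. select X Y a b S \<in> order_maps X R t
    \<and> select X Y a b (D - S) \<in> order_maps X R' t})"
  have fin: "finite (sels R R')" for R R'
    using assms(1) by (simp add: sels_def D_def)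
  have "{p' \<in> ?P. min_max X p' = (a, b)} \<subseteq> pr ` sels (C \<union> A) (C' \<union> A)"
  proof
    fix p' assume p': "p' \<in> {p' \<in> ?P. min_max X p' = (a, b)}"
    obtain f g where fg: "p' = (f, g)" by (cases p')
    have mem: "f \<in> order_maps X (C \<union> A) t" "g \<in> order_maps X (C' \<union> A) t"
      using p' by (auto simp: fg pairs_def)
    then have "f \<in> extensional X" "g \<in> extensional X"
      by (auto simp: order_maps_def PiE_def)
    then obtain S where "S \<subseteq> D" "f = select X Y a b S" "g = select X Y a b (D - S)"
      using p' D_def select_of_min_max[of X f g a b D Y] by (auto simp: fg)
    then show "p' \<in> pr ` sels (C \<union> A) (C' \<union> A)"
      using mem by (auto simp: sels_def pr_def fg)
  qed
  \<comment> \<open>For an upper bound on this fibre it suffices that \<open>pr\<close> covers it;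
    the lower bound on the fibre of \<open>?Q\<close> below uses injectivity of \<open>pr\<close>
    instead.\<close>
  then have "card {p' \<in> ?P. min_max X p' = (a, b)} \<le> card (sels (C \<union> A) (C' \<union> A))"
    using fin by (rule surj_card_le[rotated])
  also have "\<dots> \<le> card (sels (C \<union> C' \<union> A) A)"
    unfolding sels_def using assms bounds D_def by (intro card_selections_le) auto
  also have "\<dots> \<le> card {p' \<in> ?Q. min_max X p' = (a, b)}"
  proof (rule card_inj_on_le)
    show "inj_on pr (sels (C \<union> C' \<union> A) A)"
    proof (rule inj_onI)
      fix S T assume ST: "S \<in> sels (C \<union> C' \<union> A) A" "T \<in> sels (C \<union> C' \<union> A) A" "pr S = pr T"
      \<comment> \<open>Since \<open>a x < b x\<close> on \<open>D\<close>, the selected value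
        reveals whether \<open>x\<close> belongs to the set.\<close>
      have "x \<in> S \<longleftrightarrow> x \<in> T" if "x \<in> D" for x
      proof -
        have "select X Y a b S x = select X Y a b T x"
          using ST(3) by (simp add: pr_def)
        then show ?thesis
          using that by (auto simp: select_def D_def split: if_splits)
      qed
      then show "S = T"
        using ST(1,2) by (auto simp: sels_def)
    qed
    show "pr ` sels (C \<union> C' \<union> A) A \<subseteq> {p' \<in> ?Q. min_max X p' = (a, b)}"
    proof (rule image_subsetI)
      fix S assume "S \<in> sels (C \<union> C' \<union> A) A"
      then show "pr S \<in> {p' \<in> ?Q. min_max X p' = (a, b)}"
        using key[of S] weight sum_min_max[OF key[of S, unfolded pr_def]]
        by (simp add: sels_def pairs_def pr_def)
    qed
    show "finite {p' \<in> ?Q. min_max X p' = (a, b)}"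
      using \<open>finite ?Q\<close> by simp
  qed
  finally show "card {p' \<in> ?P. min_max X p' = min_max X p} \<le> card {p' \<in> ?Q. min_max X p' = min_max X p}"
    by (simp add: ab)
qed

theorem theorem5p4:
  fixes X Y Z :: "'a set"
    and prec :: "'a \<Rightarrow> 'a \<Rightarrow> bool"  (infix "\<prec>" 50)
    and C C' A :: "('a \<times> 'a) set"
    and t :: nat
  assumes "finite X"
    and "irreflp_on X (\<prec>)"
    and "transp_on X (\<prec>)"
    and "X = Y \<union> Z"
    and "Y \<inter> Z = {}"
    and "t \<ge> 1"
    and "A = within_parts (\<prec>) Y Z"
    and "C \<subseteq> Y \<times> Z"
    and "C' \<subseteq> Y \<times> Z"
  shows "Omega_q X (C \<union> C' \<union> A) t * Omega_q X A t
           \<ge>\<^sub>q Omega_q X (C \<union> A) t * Omega_q X (C' \<union> A) t"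
proof -
  have "A \<subseteq> Y \<times> Y \<union> Z \<times> Z"
    using assms(7) by (auto simp: within_parts_def)
  then show ?thesis
    using card_pairs_le[of X Y Z A C C' t] assms
    by (simp add: coeff_ge_def coeff_Omega_q_mult)
qed

end
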